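(* Let $k \ge 0$ and $n$ be integers such that $\binom{k+1}{2} \le n < \binom{k+2}{2}$. Then the number of partitions of $n$ with $k$ corners is equal to the number of ordered pairs of partitions $(\alpha,\beta)$ such that $|\alpha|+|\beta| = n-\binom{k+1}{2}$.
   Context: An integer partition is a finite weakly decreasing sequence of positive integers, called its parts; the empty sequence is allowed (it is the unique partition of $0$). The weight $|\lambda|$ of a partition $\lambda$ is the sum of its parts, and $\lambda$ is a partition of $n$ if $|\lambda|=n$. The diagram of $\lambda=(\lambda_1,\lambda_2,\ldots)$ is the set of integer points $(i,j)$ with $1\le j\le \ell(\lambda)$ and $1\le i\le\lambda_j$, where $\ell(\lambda)$ is the number of parts. A corner of $\lambda$ is a point $(i,j)$ of its diagram such that neither $(i+1,j)$ nor $(i,j+1)$ is in the diagram. A partition with $k$ corners is one whose diagram has exactly $k$ corners; equivalently, its parts take exactly $k$ distinct values. *)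

theory Defs
  imports Main
begin

definition is_partition :: "nat list \<Rightarrow> bool" where
  "is_partition l \<longleftrightarrow> sorted_wrt (\<ge>) l \<and> (\<forall>x\<in>set l. 0 < x)"

abbreviation weight :: "nat list \<Rightarrow> nat" where
  "weight l \<equiv> sum_list l"

text \<open>Points of the diagram are indexed from 1, whereas list indexing starts at 0.\<close>

definition diagram :: "nat list \<Rightarrow> (nat \<times> nat) set" where
  "diagram l = {(i, j). 1 \<le> j \<and> j \<le> length l \<and> 1 \<le> i \<and> i \<le> l ! (j - 1)}"

definition corners :: "nat list \<Rightarrow> (nat \<times> nat) set" where
  "corners l = {(i, j). (i, j) \<in> diagram l \<and> (i + 1, j) \<notin> diagram l \<and> (i, j + 1) \<notin> diagram l}"

text \<open>The sets below are finite, so \<^const>\<open>card\<close> really counts their elements.\<close>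

lemma length_le_weight: "is_partition l \<Longrightarrow> length l \<le> weight l"
  by (induction l) (auto simp: is_partition_def)

lemma finite_partitions_weight_le: "finite {l. is_partition l \<and> weight l \<le> n}"
proof (rule finite_subset)
  show "{l. is_partition l \<and> weight l \<le> n} \<subseteq> {l. set l \<subseteq> {..n} \<and> length l \<le> n}"
    using length_le_weight member_le_sum_list by fastforce
  show "finite {l. set l \<subseteq> {..n} \<and> length l \<le> n}"
    by (rule finite_lists_length_le) simp
qed

lemma finite_partitions_corners:
  "finite {l. is_partition l \<and> weight l = n \<and> card (corners l) = k}"
  by (rule finite_subset[OF _ finite_partitions_weight_le[of n]]) auto

lemma finite_partition_pairs:
  "finite {(a, b). is_partition a \<and> is_partition b \<and> weight a + weight b = m}"
  by (rule finite_subset[OF _ finite_cartesian_product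
        [OF finite_partitions_weight_le[of m] finite_partitions_weight_le[of m]]]) auto

lemma finite_diagram: "finite (diagram l)"
proof (rule finite_subset)
  show "diagram l \<subseteq> {..weight l} \<times> {..length l}"
  proof
    fix p assume "p \<in> diagram l"
    then obtain i j where p: "p = (i, j)" "1 \<le> j" "j \<le> length l" "i \<le> l ! (j - 1)"
      by (auto simp: diagram_def)
    then have "l ! (j - 1) \<le> weight l"
      by (intro member_le_sum_list nth_mem) auto
    with p show "p \<in> {..weight l} \<times> {..length l}" by auto
  qed
qed simp

lemma finite_corners: "finite (corners l)"
  by (rule finite_subset[OF _ finite_diagram[of l]]) (auto simp: corners_def)

end

theory Submission
  imports Defs "HOL-Library.Multiset"
begin

text \<open>
  The number of corners of a partition is its number of distinct part sizes. Take one copy of every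
  part size out of a partition with \<open>k\<close> corners: this leaves a partition \<open>\<alpha>\<close>, and the removed parts
  form a \<open>k\<close>-element set \<open>D\<close>. Conversely \<open>\<alpha>\<close> and \<open>D\<close> recombine to a partition with exactly \<open>k\<close> part
  sizes, because \<open>k + 1\<close> sizes would already weigh at least \<open>1 + \<dots> + (k + 1) > n\<close>. Subtracting the
  staircase \<open>k, \<dots>, 1\<close> from \<open>D\<close> gives a partition \<open>\<beta>\<close> with at most \<open>k\<close> parts, which is no restriction
  since \<open>|\<beta>| \<le> n - (1 + \<dots> + k) \<le> k\<close>.
\<close>

subsection \<open>Corners and part sizes\<close>

text \<open>Every part size is the first coordinate of exactly one corner, the one in the last row
  of that length, so \<open>fst\<close> maps the corners bijectively onto
  \<open>set l\<close>.\<close>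

lemma card_corners:
  assumes "is_partition l"
  shows "card (corners l) = card (set l)"
proof -
  have mono: "l ! j \<le> l ! i" if "i \<le> j" "j < length l" for i j
    using assms that by (cases "i = j") (auto simp: is_partition_def sorted_wrt_iff_nth_less)
  have pos: "0 < l ! i" if "i < length l" for i
    using assms that by (auto simp: is_partition_def)
  have corner_eq: "i = l ! (j - 1)" and corner_bounds: "1 \<le> j" "j \<le> length l"
    and corner_last: "j < length l \<Longrightarrow> l ! j < i" if "(i, j) \<in> corners l" for i j
    using that by (auto simp: corners_def diagram_def)
  \<comment> \<open>Row \<open>j + 1\<close> is already shorter than \<open>i\<close> because
    \<open>(i, j)\<close> is a corner, yet the later row \<open>j'\<close> would again have length
    \<open>i\<close>.\<close>
  have no_lt: False if "(i, j) \<in> corners l" "(i, j') \<in> corners l" "j < j'" for i j j'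
  proof -
    have "j < length l" "j \<le> j' - 1" "j' - 1 < length l"
      using that(3) corner_bounds[OF that(2)] by auto
    then have "l ! j < i" "l ! (j' - 1) \<le> l ! j"
      using corner_last[OF that(1)] mono by auto
    with corner_eq[OF that(2)] show False by simp
  qed
  have "inj_on fst (corners l)"
  proof (rule inj_onI, clarsimp)
    fix i j j' assume "(i, j) \<in> corners l" "(i, j') \<in> corners l"
    then show "j = j'" using no_lt by (metis nat_neq_iff)
  qed
  moreover have "fst ` corners l = set l"
  proof
    show "fst ` corners l \<subseteq> set l"
    proof clarify
      fix i j assume "(i, j) \<in> corners l"
      from corner_eq[OF this] corner_bounds[OF this] show "fst (i, j) \<in> set l" by simp
    qed
    show "set l \<subseteq> fst ` corners l"
    proof
      fix x assume "x \<in> set l"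
      define I where "I = {i. i < length l \<and> l ! i = x}"
      have fin: "finite I" and ne: "I \<noteq> {}"
        using \<open>x \<in> set l\<close> by (auto simp: I_def in_set_conv_nth)
      \<comment> \<open>The last index carrying \<open>x\<close>. The corner lies in row
        \<open>Suc m\<close>, since rows are counted from 1.\<close>
      define m where "m = Max I"
      have m: "m < length l" "l ! m = x"
        using Max_in[OF fin ne] by (auto simp: m_def I_def)
      have "l ! Suc m \<noteq> x" if "Suc m < length l"
      proof
        assume "l ! Suc m = x"
        then have "Suc m \<le> m" using Max_ge[OF fin, of "Suc m"] that by (simp add: m_def I_def)
        then show False by simp
      qed
      moreover have "l ! Suc m \<le> x" if "Suc m < length l"
        using mono[of m "Suc m"] that m by auto
      ultimately have "(x, Suc m) \<in> corners l"
        using m pos[OF m(1)] by (fastforce simp: corners_def diagram_def)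
      then show "x \<in> fst ` corners l" by force
    qed
  qed
  ultimately show ?thesis by (metis card_image)
qed

subsection \<open>Partitions and strict partitions\<close>

text \<open>Missing parts of the second argument count as \<open>0\<close>.\<close>

fun add_staircase :: "nat \<Rightarrow> nat list \<Rightarrow> nat list" where
  "add_staircase 0 xs = []"
| "add_staircase (Suc k) [] = Suc k # add_staircase k []"
| "add_staircase (Suc k) (x # xs) = (x + Suc k) # add_staircase k xs"

text \<open>In a strictly decreasing list of positive numbers, once an entry equals its staircase
  step, all later entries do too. Stopping there drops exactly the zero parts.\<close>

fun sub_staircase :: "nat list \<Rightarrow> nat list" where
  "sub_staircase [] = []"
| "sub_staircase (d # ds) =
    (if d = Suc (length ds) then [] else (d - Suc (length ds)) # sub_staircase ds)"

lemma length_add_staircase [simp]: "length (add_staircase k xs) = k"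
  by (induction k xs rule: add_staircase.induct) auto

lemma add_staircase_pos: "x \<in> set (add_staircase k xs) \<Longrightarrow> 0 < x"
  by (induction k xs rule: add_staircase.induct) auto

text \<open>Serves the induction for strict decrease: with \<open>m = x\<close> it puts the tail
  below the head \<open>x + Suc k\<close>, and with \<open>m = 0\<close> it covers the padding by
  zeros.\<close>

lemma add_staircase_le:
  "x \<in> set (add_staircase k xs) \<Longrightarrow> (\<forall>y\<in>set xs. y \<le> m) \<Longrightarrow> x \<le> m + k"
  by (induction k xs rule: add_staircase.induct) force+

lemma sorted_add_staircase:
  "sorted_wrt (\<ge>) xs \<Longrightarrow> sorted_wrt (>) (add_staircase k xs)"
proof (induction k xs rule: add_staircase.induct)
  case (2 k)
  then show ?case using add_staircase_le[of _ k "[]" 0] by force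
next
  case (3 k x xs)
  then show ?case using add_staircase_le[of _ k xs x] by force
qed auto

lemma sum_list_add_staircase:
  "length xs \<le> k \<Longrightarrow> sum_list (add_staircase k xs) = sum_list xs + (Suc k choose 2)"
  by (induction k xs rule: add_staircase.induct) (auto simp: numeral_2_eq_2)

lemma sub_add_staircase:
  "length xs \<le> k \<Longrightarrow> \<forall>x\<in>set xs. 0 < x \<Longrightarrow> sub_staircase (add_staircase k xs) = xs"
  by (induction k xs rule: add_staircase.induct) auto

text \<open>Guarantees that the subtractions in \<open>sub_staircase\<close> are never
  truncated.\<close>

lemma length_le_strict_head:
  "sorted_wrt (>) (d # ds) \<Longrightarrow> \<forall>x\<in>set (d # ds). (0::nat) < x \<Longrightarrow> length (d # ds) \<le> d"
proof (induction ds arbitrary: d)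
  case (Cons a ds)
  then have "length (a # ds) \<le> a" by auto
  with Cons.prems show ?case by auto
qed simp

lemma add_sub_staircase:
  "sorted_wrt (>) ds \<Longrightarrow> \<forall>x\<in>set ds. 0 < x \<Longrightarrow> add_staircase (length ds) (sub_staircase ds) = ds"
proof (induction ds)
  case (Cons d ds)
  note IH = Cons.IH[OF sorted_wrt.simps(2)[THEN iffD1, THEN conjunct2, OF Cons.prems(1)]]
  have le: "Suc (length ds) \<le> d"
    using length_le_strict_head[OF Cons.prems] by simp
  show ?case
  proof (cases "d = Suc (length ds)")
    case True
    \<comment> \<open>The next entry \<open>e\<close> satisfies
      \<open>length ds \<le> e < Suc (length ds)\<close>, so it equals its own staircase step and
      the recursion stops at once.\<close>
    have "sub_staircase ds = []"
    proof (cases ds)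
      case (Cons e es)
      then have "length ds \<le> e" "e < d"
        using length_le_strict_head[of e es] Cons.prems by auto
      then show ?thesis using True Cons by auto
    qed simp
    then show ?thesis using True IH Cons.prems by auto
  next
    case False
    then show ?thesis using le IH Cons.prems by auto
  qed
qed simp

lemma length_sub_staircase: "length (sub_staircase ds) \<le> length ds"
  by (induction ds) auto

text \<open>The entries fall by at least one per position and the staircase by exactly one, so the
  differences never rise above the bound at the head.\<close>

lemma sub_staircase_le:
  "sorted_wrt (>) ds \<Longrightarrow> \<forall>x\<in>set ds. x \<le> m + length ds \<Longrightarrow> y \<in> set (sub_staircase ds) \<Longrightarrow> y \<le> m"
proof (induction ds)
  case (Cons d ds)
  then show ?case by (fastforce split: if_splits)
qed simp

lemma is_partition_sub_staircase:
  "sorted_wrt (>) ds \<Longrightarrow> \<forall>x\<in>set ds. 0 < x \<Longrightarrow> is_partition (sub_staircase ds)"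
proof (induction ds)
  case (Cons d ds)
  have le: "Suc (length ds) \<le> d"
    using length_le_strict_head[OF Cons.prems] by simp
  have "y \<le> d - Suc (length ds)" if "y \<in> set (sub_staircase ds)" for y
    using sub_staircase_le[of ds "d - Suc (length ds)" y] that le Cons.prems by fastforce
  then show ?case using Cons le by (auto simp: is_partition_def)
qed (simp add: is_partition_def)

lemma strict_decreasing_iff_rev_sorted:
  fixes ds :: "nat list"
  shows "sorted_wrt (>) ds \<longleftrightarrow> sorted (rev ds) \<and> distinct (rev ds)"
  by (metis sorted_wrt_rev strict_sorted_iff)

text \<open>A finite set is the same as its strictly decreasing listing. Adding the staircase to a
  partition padded with zeros to length \<open>k\<close> makes the decrease strict, and subtracting
  it undoes this.\<close>

lemma bij_betw_add_staircase:
  "bij_betw (\<lambda>\<beta>. set (add_staircase k \<beta>))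
     {\<beta>. is_partition \<beta> \<and> length \<beta> \<le> k} {D. finite D \<and> 0 \<notin> D \<and> card D = k}"
proof (rule bij_betw_byWitness[where f' = "\<lambda>D. sub_staircase (rev (sorted_list_of_set D))"])
  have strict: "sorted_wrt (>) (add_staircase k \<beta>)" if "is_partition \<beta>" for \<beta>
    using that by (auto simp: is_partition_def intro: sorted_add_staircase)
  show "\<forall>\<beta>\<in>{\<beta>. is_partition \<beta> \<and> length \<beta> \<le> k}.
      sub_staircase (rev (sorted_list_of_set (set (add_staircase k \<beta>)))) = \<beta>"
  proof safe
    fix \<beta> assume \<beta>: "is_partition \<beta>" "length \<beta> \<le> k"
    have "sorted_list_of_set (set (add_staircase k \<beta>)) = rev (add_staircase k \<beta>)"
      using strict[OF \<beta>(1)] sorted_list_of_set.idem_if_sorted_distinct[of "rev (add_staircase k \<beta>)"]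
      by (simp add: strict_decreasing_iff_rev_sorted)
    then show "sub_staircase (rev (sorted_list_of_set (set (add_staircase k \<beta>)))) = \<beta>"
      using \<beta> by (auto simp: is_partition_def intro: sub_add_staircase)
  qed
  show "(\<lambda>\<beta>. set (add_staircase k \<beta>)) ` {\<beta>. is_partition \<beta> \<and> length \<beta> \<le> k}
      \<subseteq> {D. finite D \<and> 0 \<notin> D \<and> card D = k}"
  proof clarsimp
    fix \<beta> assume "is_partition \<beta>"
    then have "distinct (add_staircase k \<beta>)"
      using strict strict_decreasing_iff_rev_sorted by auto
    then show "0 \<notin> set (add_staircase k \<beta>) \<and> card (set (add_staircase k \<beta>)) = k"
      using add_staircase_pos by (fastforce simp: distinct_card)
  qed
  have D: "sorted_wrt (>) (rev (sorted_list_of_set D))"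
    "\<forall>x\<in>set (rev (sorted_list_of_set D)). 0 < x"
    "length (rev (sorted_list_of_set D)) = k"
    if "finite D" "0 \<notin> D" "card D = k" for D :: "nat set"
    using that by (auto simp: strict_decreasing_iff_rev_sorted intro: gr0I)
  show "\<forall>D\<in>{D. finite D \<and> 0 \<notin> D \<and> card D = k}.
      set (add_staircase k (sub_staircase (rev (sorted_list_of_set D)))) = D"
  proof clarify
    fix D :: "nat set" assume *: "finite D" "0 \<notin> D" "k = card D"
    show "set (add_staircase (card D) (sub_staircase (rev (sorted_list_of_set D)))) = D"
      using add_sub_staircase[OF D(1,2)] D(3) * by simp
  qed
  show "(\<lambda>D. sub_staircase (rev (sorted_list_of_set D))) ` {D. finite D \<and> 0 \<notin> D \<and> card D = k}
      \<subseteq> {\<beta>. is_partition \<beta> \<and> length \<beta> \<le> k}"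
  proof clarify
    fix D :: "nat set" assume *: "finite D" "0 \<notin> D" "k = card D"
    then show "is_partition (sub_staircase (rev (sorted_list_of_set D))) \<and>
        length (sub_staircase (rev (sorted_list_of_set D))) \<le> card D"
      using is_partition_sub_staircase[OF D(1,2)] length_sub_staircase D(3) by metis
  qed
qed

lemma sum_set_add_staircase:
  assumes "is_partition \<beta>" "length \<beta> \<le> k"
  shows "\<Sum> (set (add_staircase k \<beta>)) = weight \<beta> + ((k + 1) choose 2)"
proof -
  have "distinct (add_staircase k \<beta>)"
    using assms(1) sorted_add_staircase[of \<beta> k] strict_decreasing_iff_rev_sorted
    by (auto simp: is_partition_def)
  then show ?thesis
    using sum_list_add_staircase[OF assms(2)] by (simp add: sum.distinct_set_conv_list)
qed

text \<open>\<open>D\<close> arises from some \<beta> by adding the staircase, so its sum exceeds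
  the binomial coefficient by the weight of \<beta>.\<close>

lemma choose_two_le_sum:
  assumes "finite D" "(0::nat) \<notin> D"
  shows "(card D + 1) choose 2 \<le> \<Sum> D"
proof -
  have "D \<in> (\<lambda>\<beta>. set (add_staircase (card D) \<beta>)) ` {\<beta>. is_partition \<beta> \<and> length \<beta> \<le> card D}"
    using bij_betw_add_staircase[of "card D"] assms by (simp add: bij_betw_def)
  then obtain \<beta> where "is_partition \<beta>" "length \<beta> \<le> card D" "D = set (add_staircase (card D) \<beta>)"
    by blast
  then show ?thesis using sum_set_add_staircase by (metis le_add2)
qed

subsection \<open>Separating one copy of every part size\<close>

text \<open>The canonical decreasing listing; it lets parts be removed and added at the level of
  multisets.\<close>

definition part_list :: "nat multiset \<Rightarrow> nat list" where
  "part_list M = rev (sorted_list_of_multiset M)"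

lemma mset_part_list [simp]: "mset (part_list M) = M"
  by (simp add: part_list_def)

lemma set_part_list [simp]: "set (part_list M) = set_mset M"
  by (simp add: part_list_def)

lemma weight_part_list [simp]: "weight (part_list M) = sum_mset M"
  by (metis mset_part_list sum_mset_sum_list)

lemma is_partition_part_list: "is_partition (part_list M) \<longleftrightarrow> 0 \<notin># M"
  by (auto simp: is_partition_def part_list_def sorted_wrt_rev intro: gr0I)

lemma part_list_mset: "is_partition l \<Longrightarrow> part_list (mset l) = l"
  unfolding part_list_def is_partition_def
  by (metis rev_rev_ident mset_rev sorted_list_of_multiset_mset sorted_sort_id sorted_wrt_rev)

lemma sum_mset_mset_set: "sum_mset (mset_set D) = \<Sum> D"
  by (simp add: sum_unfold_sum_mset)

lemma sum_set_le_weight: "\<Sum> (set_mset M) \<le> sum_mset (M :: nat multiset)"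
  using arg_cong[OF subset_mset.diff_add[OF mset_set_set_mset_msubset[of M]], of sum_mset]
  by (simp add: sum_mset_mset_set)

lemma bij_betw_separate:
  assumes "n < (k + 2) choose 2"
  shows "bij_betw (\<lambda>l. (part_list (mset l - mset_set (set l)), set l))
    {l. is_partition l \<and> weight l = n \<and> card (set l) = k}
    {(\<alpha>, D). is_partition \<alpha> \<and> (finite D \<and> 0 \<notin> D \<and> card D = k) \<and> weight \<alpha> + \<Sum> D = n}"
    (is "bij_betw ?f ?L ?S")
proof (rule bij_betw_byWitness[where f' = "\<lambda>(\<alpha>, D). part_list (mset \<alpha> + mset_set D)"])
  have split: "mset l - mset_set (set l) + mset_set (set l) = mset l" for l :: "nat list"
    using mset_set_set_mset_msubset[of "mset l"] by simp
  show "\<forall>l\<in>?L. (case ?f l of (\<alpha>, D) \<Rightarrow> part_list (mset \<alpha> + mset_set D)) = l"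
    by (simp add: split part_list_mset)
  show "?f ` ?L \<subseteq> ?S"
  proof clarsimp
    fix l assume l: "is_partition l"
    then have "0 \<notin> set l" by (auto simp: is_partition_def)
    moreover from this have "0 \<notin># mset l - mset_set (set l)"
      by (meson in_diffD set_mset_mset in_multiset_in_set)
    moreover have "sum_mset (mset l - mset_set (set l)) + \<Sum> (set l) = weight l"
      using arg_cong[OF split[of l], of sum_mset] by (simp add: sum_mset_mset_set sum_mset_sum_list)
    ultimately show "is_partition (part_list (mset l - mset_set (set l))) \<and> 0 \<notin> set l \<and>
        sum_mset (mset l - mset_set (set l)) + \<Sum> (set l) = weight l"
      by (simp add: is_partition_part_list)
  qed
  \<comment> \<open>Here the bound on \<open>n\<close> enters: a size of \<alpha> outside
    \<open>D\<close> would give at least \<open>k + 1\<close> distinct sizes, hence weight at least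
    \<open>(k + 2) choose 2\<close>.\<close>
  have set_subset: "set \<alpha> \<subseteq> D"
    if \<alpha>: "is_partition \<alpha>" and D: "finite D" "0 \<notin> D" "card D = k" and w: "weight \<alpha> + \<Sum> D = n"
    for \<alpha> D
  proof -
    let ?U = "set \<alpha> \<union> D"
    have "set_mset (mset \<alpha> + mset_set D) = ?U" using D by simp
    then have "\<Sum> ?U \<le> n"
      using sum_set_le_weight[of "mset \<alpha> + mset_set D"] w
      by (simp add: sum_mset_mset_set sum_mset_sum_list)
    moreover have "(card ?U + 1) choose 2 \<le> \<Sum> ?U"
      using \<alpha> D by (intro choose_two_le_sum) (auto simp: is_partition_def)
    ultimately have "(card ?U + 1) choose 2 < (k + 2) choose 2" using assms by linarith
    then have "card ?U \<le> k"
      using binomial_right_mono[of "k + 2" "card ?U + 1" 2] by linarith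
    then have "D = ?U" using D by (intro card_seteq) auto
    then show ?thesis by blast
  qed
  have comb: "set (part_list (mset \<alpha> + mset_set D)) = D" if "(\<alpha>, D) \<in> ?S" for \<alpha> D
    using that set_subset[of \<alpha> D] by auto
  \<comment> \<open>By \<open>comb\<close> the part sizes of the recombined partition are exactly
    \<open>D\<close>, so taking out one copy of each gives back \<alpha>.\<close>
  show "\<forall>p\<in>?S. ?f (case p of (\<alpha>, D) \<Rightarrow> part_list (mset \<alpha> + mset_set D)) = p"
    using comb by (auto simp: part_list_mset simp del: set_part_list)
  show "(\<lambda>(\<alpha>, D). part_list (mset \<alpha> + mset_set D)) ` ?S \<subseteq> ?L"
  proof (clarify, intro conjI)
    fix \<alpha> D assume *: "is_partition \<alpha>" "finite D" "0 \<notin> D" "k = card D" "n = weight \<alpha> + \<Sum> D"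
    then show "is_partition (part_list (mset \<alpha> + mset_set D))"
      unfolding is_partition_part_list by (auto simp: is_partition_def)
    show "weight (part_list (mset \<alpha> + mset_set D)) = weight \<alpha> + \<Sum> D"
      by (simp add: sum_mset_mset_set sum_mset_sum_list)
    show "card (set (part_list (mset \<alpha> + mset_set D))) = card D"
      using comb[of \<alpha> D] * by auto
  qed
qed

section \<open>Composing the two bijections\<close>

theorem theorem1:
  fixes k n :: nat
  assumes "(k + 1) choose 2 \<le> n" and "n < (k + 2) choose 2"
  shows "card {l. is_partition l \<and> weight l = n \<and> card (corners l) = k} =
         card {(\<alpha>, \<beta>). is_partition \<alpha> \<and> is_partition \<beta> \<and>
                        weight \<alpha> + weight \<beta> = n - ((k + 1) choose 2)}"
    (is "card ?L = card ?P")
proof -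
  let ?T = "(k + 1) choose 2"
  let ?L' = "{l. is_partition l \<and> weight l = n \<and> card (set l) = k}"
  let ?Ds = "{D. finite D \<and> (0::nat) \<notin> D \<and> card D = k}"
  let ?Bs = "{\<beta>. is_partition \<beta> \<and> length \<beta> \<le> k}"
  let ?S = "{(\<alpha>, D). is_partition \<alpha> \<and> (finite D \<and> 0 \<notin> D \<and> card D = k) \<and> weight \<alpha> + \<Sum> D = n}"
  let ?g = "\<lambda>\<beta>. set (add_staircase k \<beta>)"
  \<comment> \<open>The two binomial coefficients differ by \<open>k + 1\<close>. As a partition has
    at most as many parts as its weight, \<beta> then fits onto the staircase of length
    \<open>k\<close>.\<close>
  have "n - ?T \<le> k" using assms by (simp add: numeral_2_eq_2)
  then have short: "length \<beta> \<le> k" if "(\<alpha>, \<beta>) \<in> ?P" for \<alpha> \<beta>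
    using that length_le_weight[of \<beta>] by auto
  have g: "inj_on ?g ?Bs" "?g ` ?Bs = ?Ds"
    using bij_betw_add_staircase[of k] by (auto simp: bij_betw_def)
  have "bij_betw (map_prod id ?g) ?P ?S"
    unfolding bij_betw_def
  proof
    show "inj_on (map_prod id ?g) ?P"
    proof (rule inj_on_subset)
      show "inj_on (map_prod id ?g) (UNIV \<times> ?Bs)"
        using g(1) by (intro map_prod_inj_on) auto
    qed (use short in auto)
    show "map_prod id ?g ` ?P = ?S"
    proof (intro equalityI subsetI)
      fix p assume "p \<in> map_prod id ?g ` ?P"
      then obtain \<alpha> \<beta> where ab: "(\<alpha>, \<beta>) \<in> ?P" and p: "p = (\<alpha>, ?g \<beta>)" by auto
      have "?g \<beta> \<in> ?Ds" using g(2) short[OF ab] ab by blast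
      \<comment> \<open>The lower bound on \<open>n\<close> is what makes adding \<open>?T\<close>
        back to the natural-number difference \<open>n - ?T\<close> return \<open>n\<close>.\<close>
      then show "p \<in> ?S"
        using ab p sum_set_add_staircase[of \<beta> k] short[OF ab] assms(1) by auto
    next
      fix p assume "p \<in> ?S"
      then obtain \<alpha> D where aD: "is_partition \<alpha>" "D \<in> ?Ds" "weight \<alpha> + \<Sum> D = n"
        and p: "p = (\<alpha>, D)" by auto
      then obtain \<beta> where b: "\<beta> \<in> ?Bs" "D = ?g \<beta>" using g(2) by blast
      then have "(\<alpha>, \<beta>) \<in> ?P" using aD sum_set_add_staircase[of \<beta> k] by auto
      then show "p \<in> map_prod id ?g ` ?P" using p b(2) by force
    qed
  qed
  then have "card ?P = card ?S" by (rule bij_betw_same_card)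
  also have "\<dots> = card ?L'"
    using bij_betw_same_card[OF bij_betw_separate[OF assms(2)]] by simp
  also have "?L' = ?L" using card_corners by auto
  finally show ?thesis by simp
qed

end
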